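(* Let $f:\mathbb{B}^n\to\mathbb{B}^N$ be a minimal holomorphic map. Then there is a group homomorphism $\Phi:\Gamma_f\to T_f\subseteq\mathrm{Aut}(\mathbb{B}^N)$ with respect to which $f$ is equivariant; that is, $f\circ\gamma=\Phi(\gamma)\circ f$ for every $\gamma\in\Gamma_f$.
   Context: $\mathbb{B}^k$ is the open unit ball in $\mathbb{C}^k$ and $\mathrm{Aut}(\mathbb{B}^k)$ is its group of holomorphic automorphisms. For holomorphic $f:\mathbb{B}^n\to\mathbb{B}^N$, let $A_f$ be the group of pairs $(\gamma,\psi)\in \mathrm{Aut}(\mathbb{B}^n)\times\mathrm{Aut}(\mathbb{B}^N)$ with $f\circ\gamma=\psi\circ f$; $\Gamma_f$ and $T_f$ are the projections of $A_f$ to the first and second factors. The map $f$ is minimal if its image lies in no affine linear subspace of $\mathbb{C}^N$ of dimension less than $N$. *)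

theory Defs
  imports "HOL-Analysis.Analysis" "HOL-Algebra.Bij"
begin

definition holomorphic_map_on ::
  "(complex ^ 'n \<Rightarrow> complex ^ 'm) \<Rightarrow> (complex ^ 'n) set \<Rightarrow> bool" where
  "holomorphic_map_on f S \<longleftrightarrow>
     (\<forall>z\<in>S. \<exists>D. Vector_Spaces.linear (*s) (*s) D \<and> (f has_derivative D) (at z within S))"

text \<open>
  As in \<^const>\<open>BijGroup\<close>, an automorphism is represented by a function that is
  \<^const>\<open>undefined\<close> outside the ball, so that equality in the group is equality on the ball.
\<close>

definition ball_aut :: "(complex ^ 'k \<Rightarrow> complex ^ 'k) monoid" where
  "ball_aut = (BijGroup (ball 0 1))\<lparr>carrier :=
     {\<gamma> \<in> Bij (ball 0 1). holomorphic_map_on \<gamma> (ball 0 1) \<and>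
        holomorphic_map_on (inv_into (ball 0 1) \<gamma>) (ball 0 1)}\<rparr>"

definition equivariant_pairs ::
  "(complex ^ 'n \<Rightarrow> complex ^ 'm) \<Rightarrow>
    ((complex ^ 'n \<Rightarrow> complex ^ 'n) \<times> (complex ^ 'm \<Rightarrow> complex ^ 'm)) set" where
  "equivariant_pairs f =
     {(\<gamma>, \<psi>). (\<gamma>, \<psi>) \<in> carrier (ball_aut \<times>\<times> ball_aut) \<and>
        (\<forall>z\<in>ball 0 1. f (\<gamma> z) = \<psi> (f z))}"

definition source_group ::
  "(complex ^ 'n \<Rightarrow> complex ^ 'm) \<Rightarrow> (complex ^ 'n \<Rightarrow> complex ^ 'n) monoid" where
  "source_group f = ball_aut\<lparr>carrier := fst ` equivariant_pairs f\<rparr>"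

definition target_group ::
  "(complex ^ 'n \<Rightarrow> complex ^ 'm) \<Rightarrow> (complex ^ 'm \<Rightarrow> complex ^ 'm) monoid" where
  "target_group f = ball_aut\<lparr>carrier := snd ` equivariant_pairs f\<rparr>"

text \<open>
  Affine subspaces and their dimension are complex: \<open>vec.subspace\<close> and \<open>vec.dim\<close> refer to the
  vector space structure over the field of scalars, unlike \<^const>\<open>subspace\<close>, \<^const>\<open>affine\<close> and
  \<^const>\<open>dim\<close>, which are real.
\<close>

definition minimal_map :: "(complex ^ 'n \<Rightarrow> complex ^ 'm) \<Rightarrow> bool" where
  "minimal_map f \<longleftrightarrow>
     \<not> (\<exists>a V. vec.subspace V \<and> vec.dim V < CARD('m) \<and> f ` ball 0 1 \<subseteq> (+) a ` V)"

end

theory Submission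
  imports Defs "HOL-Complex_Analysis.Conformal_Mappings"
begin

text \<open>
  The map \<open>\<Phi>\<close> has to send \<open>\<gamma>\<close> to some \<open>\<psi>\<close> with \<open>f \<circ> \<gamma> = \<psi> \<circ> f\<close>. The pairs \<open>(\<gamma>, \<psi>)\<close> form a
  subgroup of the product of the two automorphism groups, so as soon as \<open>\<psi>\<close> is determined by
  \<open>\<gamma>\<close> this subgroup is the graph of a homomorphism. All the content is therefore in the
  uniqueness of \<open>\<psi>\<close> (\<open>equivariant_pairs_unique\<close>).

  If \<open>\<psi>\<close> and \<open>\<psi>'\<close> both belong to \<open>\<gamma>\<close>, then \<open>inv \<psi>' \<circ> \<psi>\<close> fixes every point of the image of \<open>f\<close>,
  so it suffices that the fixed points of an automorphism of the ball other than the identity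
  lie in a proper complex affine subspace (\<open>ball_automorphism_eq_id\<close>). For an automorphism
  fixing the origin this holds because it is linear: by the Schwarz lemma on the complex lines
  through the origin, applied to the automorphism and to its inverse, it preserves the norm, and
  the equality case of the Schwarz lemma makes it linear on each line, hence equal to its
  derivative (\<open>ball_isometry_linear\<close>). A general automorphism with a fixed point \<open>a\<close> is
  conjugated to such a one by the Moebius involution exchanging \<open>a\<close> and the origin. This
  involution is a quotient of affine maps that takes \<open>a\<close> to the origin, so it pulls back
  linear subspaces to affine subspaces through \<open>a\<close>, and the fixed points of the original
  automorphism again lie in an affine subspace.
\<close>

section \<open>The Hermitian inner product\<close>

definition cinner :: "complex ^ 'n \<Rightarrow> complex ^ 'n \<Rightarrow> complex" where
  "cinner z w = (\<Sum>i\<in>UNIV. z $ i * cnj (w $ i))"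

lemma cinner_add_left: "cinner (x + y) z = cinner x z + cinner y z"
  by (simp add: cinner_def distrib_right sum.distrib)

lemma cinner_add_right: "cinner x (y + z) = cinner x y + cinner x z"
  by (simp add: cinner_def distrib_left sum.distrib)

lemma cinner_scale_left: "cinner (c *s x) z = c * cinner x z"
  by (simp add: cinner_def sum_distrib_left mult.assoc)

lemma cinner_scale_right: "cinner x (c *s z) = cnj c * cinner x z"
  by (simp add: cinner_def sum_distrib_left mult_ac)

lemma cinner_minus_left: "cinner (- x) z = - cinner x z"
  by (simp add: cinner_def sum_negf)

lemma cinner_minus_right: "cinner x (- z) = - cinner x z"
  by (simp add: cinner_def sum_negf)

lemma cinner_diff_left: "cinner (x - y) z = cinner x z - cinner y z"
  using cinner_add_left[of x "- y" z] by (simp add: cinner_minus_left)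

lemma cinner_diff_right: "cinner x (y - z) = cinner x y - cinner x z"
  using cinner_add_right[of x y "- z"] by (simp add: cinner_minus_right)

lemmas cinner_expand = cinner_add_left cinner_add_right cinner_diff_left cinner_diff_right
  cinner_scale_left cinner_scale_right cinner_minus_left cinner_minus_right

lemma cnj_cinner: "cnj (cinner x y) = cinner y x"
  by (simp add: cinner_def mult.commute)

lemma cinner_self: "cinner x x = of_real ((norm x)\<^sup>2)"
proof -
  have "(norm x)\<^sup>2 = (\<Sum>i\<in>UNIV. (cmod (x $ i))\<^sup>2)"
    by (simp add: norm_vec_def L2_set_def sum_nonneg)
  then show ?thesis
    by (simp only: cinner_def of_real_sum complex_norm_square)
qed

lemma cmod_cinner_le: "cmod (cinner x y) \<le> norm x * norm y"
proof -
  have "cmod (cinner x y) \<le> (\<Sum>i\<in>UNIV. \<bar>cmod (x $ i)\<bar> * \<bar>cmod (y $ i)\<bar>)"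
    unfolding cinner_def by (rule order_trans[OF norm_sum]) (simp add: norm_mult)
  also have "\<dots> \<le> norm x * norm y"
    unfolding norm_vec_def by (rule L2_set_mult_ineq)
  finally show ?thesis .
qed

lemma norm_vector_scale: "norm (c *s x) = cmod c * norm (x :: complex ^ 'n)"
  by (simp add: norm_vec_def norm_mult L2_set_right_distrib)

text \<open>
  Equality in the Cauchy-Schwarz inequality: the component of \<open>x\<close> orthogonal to the unit vector
  \<open>v\<close> has squared norm \<open>\<parallel>x\<parallel>\<^sup>2 - \<bar>\<langle>x, v\<rangle>\<bar>\<^sup>2\<close>.
\<close>

lemma cinner_equality_case:
  assumes "norm v = 1" and "norm x = cmod (cinner x v)"
  shows "x = cinner x v *s v"
proof -
  define c where "c = cinner x v"
  have "cinner (x - c *s v) (x - c *s v)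
      = cinner x x - cnj c * cinner x v - c * (cinner v x - cnj c * cinner v v)"
    by (simp add: cinner_expand algebra_simps)
  also have "\<dots> = 0"
    unfolding cinner_self assms cnj_cinner[of x v, symmetric] c_def[symmetric]
    using complex_norm_square[of c] by (simp add: mult.commute)
  finally have "cinner (x - c *s v) (x - c *s v) = 0" .
  then show ?thesis
    by (simp add: cinner_self c_def)
qed

lemma bounded_bilinear_vector_scale:
  "bounded_bilinear ((*s) :: complex \<Rightarrow> complex ^ 'n \<Rightarrow> complex ^ 'n)"
proof (rule bounded_bilinear.intro)
  show "\<exists>K. \<forall>a b. norm (a *s b :: complex ^ 'n) \<le> norm a * norm b * K"
    by (rule exI[of _ 1]) (simp add: norm_vector_scale)
qed (simp_all add: vec_eq_iff algebra_simps scaleR_conv_of_real[where 'a = complex])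

lemma bounded_linear_cinner_left: "bounded_linear (\<lambda>z. cinner z a)"
  by (rule bounded_linear_intro[where K = "norm a"])
     (simp_all add: cinner_add_left cmod_cinner_le,
       simp add: cinner_def scaleR_conv_of_real[where 'a = complex] sum_distrib_left mult.assoc)

lemma linear_vectorI:
  fixes D :: "complex ^ 'n \<Rightarrow> complex ^ 'm"
  assumes "\<And>x y. D (x + y) = D x + D y" and "\<And>c x. D (c *s x) = c *s D x"
  shows "Vector_Spaces.linear (*s) (*s) D"
  using assms by (simp add: Vector_Spaces.linear_iff vec.vector_space_axioms)

section \<open>Automorphisms fixing the origin\<close>

lemma holomorphic_map_onE:
  assumes "holomorphic_map_on f S" "open S" "z \<in> S"
  obtains D where "Vector_Spaces.linear (*s) (*s) D" "(f has_derivative D) (at z)"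
  using assms at_within_open[of z S] unfolding holomorphic_map_on_def by metis

lemma has_derivative_vector_scale: "((\<lambda>t. t *s u) has_derivative (\<lambda>t. t *s u)) (at t)"
  for u :: "complex ^ 'n"
  by (rule bounded_linear_imp_has_derivative)
    (rule bounded_bilinear.bounded_linear_left[OF bounded_bilinear_vector_scale])

lemma has_derivative_slice:
  fixes \<phi> :: "complex ^ 'n \<Rightarrow> complex ^ 'm"
  assumes "(\<phi> has_derivative D) (at (t *s u))"
  shows "((\<lambda>t. \<phi> (t *s u)) has_derivative (\<lambda>t. D (t *s u))) (at t)"
  using has_derivative_vector_scale assms by (rule has_derivative_compose)

text \<open>
  Restricting to a complex line and projecting to another one reduces statements about maps of
  balls to the one-variable Schwarz lemma.
\<close>

lemma holomorphic_slice:
  fixes \<phi> :: "complex ^ 'n \<Rightarrow> complex ^ 'm"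
  assumes "holomorphic_map_on \<phi> (ball 0 1)" and "norm u = 1"
  shows "(\<lambda>t. cinner (\<phi> (t *s u)) v) holomorphic_on ball 0 1"
proof -
  have "(\<lambda>t. cinner (\<phi> (t *s u)) v) field_differentiable at t" if "t \<in> ball 0 1" for t
  proof -
    have "t *s u \<in> ball 0 1"
      using that assms(2) by (simp add: norm_vector_scale)
    with assms(1) obtain D where D: "Vector_Spaces.linear (*s) (*s) D"
      and der: "(\<phi> has_derivative D) (at (t *s u))"
      using holomorphic_map_onE by blast
    from bounded_linear.has_derivative[OF bounded_linear_cinner_left has_derivative_slice[OF der]]
    have "((\<lambda>t. cinner (\<phi> (t *s u)) v) has_derivative (\<lambda>t. cinner (D (t *s u)) v)) (at t)" .
    moreover have "cinner (D (t *s u)) v = cinner (D u) v * t" for t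
      by (simp add: vec.linear_scale[OF D] cinner_scale_left)
    ultimately show ?thesis
      unfolding field_differentiable_def has_field_derivative_def by (auto simp: fun_eq_iff)
  qed
  then show ?thesis
    by (simp add: holomorphic_on_def field_differentiable_at_within)
qed

lemma normalized_vector:
  fixes z :: "complex ^ 'n"
  assumes "z \<noteq> 0"
  obtains u where "norm u = 1" "z = of_real (norm z) *s u"
proof
  show "norm (of_real (inverse (norm z)) *s z) = 1"
    using assms by (simp add: norm_vector_scale norm_inverse)
  show "z = of_real (norm z) *s (of_real (inverse (norm z)) *s z)"
    using assms by simp
qed

text \<open>
  The Schwarz lemma for balls: the slice through \<open>z\<close>, projected to the direction of \<open>\<phi> z\<close>, is a
  self-map of the disc fixing the origin.
\<close>

lemma ball_map_norm_le:
  fixes \<phi> :: "complex ^ 'n \<Rightarrow> complex ^ 'm"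
  assumes hol: "holomorphic_map_on \<phi> (ball 0 1)" and maps: "\<phi> \<in> ball 0 1 \<rightarrow> ball 0 1"
    and zero: "\<phi> 0 = 0" and z: "norm z < 1"
  shows "norm (\<phi> z) \<le> norm z"
proof (cases "z = 0 \<or> \<phi> z = 0")
  case False
  obtain u where u: "norm u = 1" "z = of_real (norm z) *s u"
    using False normalized_vector by blast
  obtain v where v: "norm v = 1" "\<phi> z = of_real (norm (\<phi> z)) *s v"
    using False normalized_vector by blast
  have "cmod (cinner (\<phi> (of_real (norm z) *s u)) v) \<le> cmod (of_real (norm z))"
  proof (rule Schwarz_Lemma(1)[OF holomorphic_slice[OF hol u(1)]])
    show "cmod (cinner (\<phi> (t *s u)) v) < 1" if "cmod t < 1" for t
    proof -
      have "t *s u \<in> ball 0 1"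
        using that u(1) by (simp add: norm_vector_scale)
      then have "norm (\<phi> (t *s u)) < 1"
        using maps by (simp add: Pi_iff)
      then show ?thesis
        using cmod_cinner_le[of "\<phi> (t *s u)" v] v(1) by simp
    qed
  qed (use zero z in \<open>simp_all add: cinner_def\<close>)
  moreover have "cmod (cinner (\<phi> z) v) = norm (\<phi> z)"
    by (subst v(2)) (simp add: cinner_scale_left cinner_self v(1))
  ultimately show ?thesis
    using u(2) by simp
qed (use zero in auto)

text \<open>
  The equality case of the Schwarz lemma determines the slice from a single point. Projected to
  the direction \<open>v\<close> of its value at parameter \<open>1/2\<close>, the slice attains equality there, so the
  projection is the identity \<open>t\<close>. As \<open>\<phi> (t *s u)\<close> has norm \<open>\<bar>t\<bar>\<close> too, nothing is left
  orthogonally to \<open>v\<close>.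
\<close>

lemma ball_isometry_slice:
  fixes \<phi> :: "complex ^ 'n \<Rightarrow> complex ^ 'm"
  assumes hol: "holomorphic_map_on \<phi> (ball 0 1)"
    and iso: "\<And>z. norm z < 1 \<Longrightarrow> norm (\<phi> z) = norm z"
    and u: "norm u = 1"
  obtains v where "\<And>t. cmod t < 1 \<Longrightarrow> \<phi> (t *s u) = t *s v"
proof -
  \<comment> \<open>Any nonzero parameter in the disc could replace \<open>1/2\<close>.\<close>
  let ?x = "\<phi> ((1/2) *s u)"
  have x: "norm ?x = 1/2"
    using iso[of "(1/2) *s u"] u by (simp add: norm_vector_scale)
  then have "?x \<noteq> 0"
    by auto
  then obtain v where v: "norm v = 1" "?x = of_real (norm ?x) *s v"
    using normalized_vector by blast
  define h where "h = (\<lambda>t. cinner (\<phi> (t *s u)) v)"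
  have h_lt: "cmod (h t) < 1" if "cmod t < 1" for t
    using cmod_cinner_le[of "\<phi> (t *s u)" v] that u v iso[of "t *s u"]
    by (simp add: norm_vector_scale h_def)
  have h_half: "h (1/2) = 1/2"
    unfolding h_def by (subst v(2)) (simp add: x v(1) cinner_scale_left cinner_self)
  have h0: "h 0 = 0"
    using iso[of 0] by (simp add: h_def cinner_def)
  have "\<exists>\<alpha>. (\<forall>z. cmod z < 1 \<longrightarrow> h z = \<alpha> * z) \<and> cmod \<alpha> = 1"
  proof (rule Schwarz_Lemma(3)[of h 0])
    show "h holomorphic_on ball 0 1"
      unfolding h_def by (rule holomorphic_slice[OF hol u])
    show "(\<exists>z. cmod z < 1 \<and> z \<noteq> 0 \<and> cmod (h z) = cmod z) \<or> cmod (deriv h 0) = 1"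
      by (intro disjI1 exI[of _ "1/2"]) (simp add: h_half)
  qed (simp_all add: h0 h_lt)
  then obtain \<alpha> where \<alpha>: "\<And>t. cmod t < 1 \<Longrightarrow> h t = \<alpha> * t"
    by blast
  have "\<alpha> = 1"
    using \<alpha>[of "1/2"] h_half by simp
  then have "\<phi> (t *s u) = t *s v" if "cmod t < 1" for t
    using cinner_equality_case[OF v(1), of "\<phi> (t *s u)"] \<alpha>[OF that] iso[of "t *s u"] that u
    by (simp add: norm_vector_scale h_def)
  with that show thesis by blast
qed

text \<open>
  Each slice being linear by itself does not yet make the map additive; linearity comes from
  comparing the slices with the complex derivative at the origin, which must agree with each of
  them.
\<close>

lemma ball_isometry_linear:
  fixes \<phi> :: "complex ^ 'n \<Rightarrow> complex ^ 'm"
  assumes hol: "holomorphic_map_on \<phi> (ball 0 1)"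
    and iso: "\<And>z. norm z < 1 \<Longrightarrow> norm (\<phi> z) = norm z"
  obtains D where "Vector_Spaces.linear (*s) (*s) D" "\<And>z. norm z < 1 \<Longrightarrow> \<phi> z = D z"
proof -
  obtain D where D: "Vector_Spaces.linear (*s) (*s) D" and der: "(\<phi> has_derivative D) (at 0)"
    using holomorphic_map_onE[OF hol, of 0] by auto
  have "\<phi> z = D z" if z: "norm z < 1" for z :: "complex ^ 'n"
  proof (cases "z = 0")
    case True
    then show ?thesis
      using iso[of 0] vec.linear_0[OF D] by simp
  next
    case False
    obtain u where u: "norm u = 1" "z = of_real (norm z) *s u"
      using False normalized_vector by blast
    obtain v where v: "\<And>t. cmod t < 1 \<Longrightarrow> \<phi> (t *s u) = t *s v"
      using ball_isometry_slice[OF hol iso u(1)] by blast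
    have "((\<lambda>t. \<phi> (t *s u)) has_derivative (\<lambda>t. D (t *s u))) (at 0)"
      by (rule has_derivative_slice) (simp add: der)
    moreover have "((\<lambda>t. \<phi> (t *s u)) has_derivative (\<lambda>t. t *s v)) (at 0)"
      by (rule has_derivative_transform_within_open[OF has_derivative_vector_scale open_ball, of _ 0 1])
        (simp_all add: v)
    ultimately have "(\<lambda>t. D (t *s u)) = (\<lambda>t. t *s v)"
      by (rule has_derivative_unique)
    then have "D (of_real (norm z) *s u) = of_real (norm z) *s v"
      by (rule fun_cong)
    then show ?thesis
      using v[of "of_real (norm z)"] u(2) z by simp
  qed
  with D that show thesis by blast
qed

section \<open>Moebius involutions of the ball\<close>

definition moebius_scale :: "complex ^ 'n \<Rightarrow> real" where
  "moebius_scale a = sqrt (1 - (norm a)\<^sup>2)"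

text \<open>
  For \<open>\<parallel>a\<parallel> < 1\<close>, this map is the identity on the line spanned by \<open>a\<close>, and on the orthogonal
  complement of \<open>a\<close> it is multiplication by \<open>s = moebius_scale a\<close>. The usual formula \<open>P + s Q\<close>
  with the projections \<open>P\<close> and \<open>Q = 1 - P\<close> has \<open>\<parallel>a\<parallel>\<^sup>2\<close> in the denominator of \<open>P\<close>; since
  \<open>\<parallel>a\<parallel>\<^sup>2 = (1 - s) (1 + s)\<close>, the form chosen here is equal to it and also covers \<open>a = 0\<close>.
\<close>

definition moebius_linear :: "complex ^ 'n \<Rightarrow> complex ^ 'n \<Rightarrow> complex ^ 'n" where
  "moebius_linear a z = of_real (moebius_scale a) *s z
     + (cinner z a / of_real (1 + moebius_scale a)) *s a"

definition ball_moebius :: "complex ^ 'n \<Rightarrow> complex ^ 'n \<Rightarrow> complex ^ 'n" where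
  "ball_moebius a z = inverse (1 - cinner z a) *s (a - moebius_linear a z)"

lemma linear_moebius_linear: "Vector_Spaces.linear (*s) (*s) (moebius_linear a)"
  by (rule linear_vectorI)
    (simp_all add: moebius_linear_def cinner_expand vec_eq_iff add_divide_distrib algebra_simps)

lemma moebius_scale_pos: "norm a < 1 \<Longrightarrow> 0 < moebius_scale a"
  by (simp add: moebius_scale_def power_less_one_iff)

lemma moebius_scale_square: "norm a < 1 \<Longrightarrow> (moebius_scale a)\<^sup>2 = 1 - (norm a)\<^sup>2"
  by (simp add: moebius_scale_def power_le_one)

context
  fixes a :: "complex ^ 'n"
  assumes a: "norm a < 1"
begin

lemma moebius_coefficient:
  "(of_real ((norm a)\<^sup>2) :: complex) / of_real (1 + moebius_scale a) = 1 - of_real (moebius_scale a)"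
proof -
  have "(norm a)\<^sup>2 / (1 + moebius_scale a) = 1 - moebius_scale a"
    using moebius_scale_pos[OF a] moebius_scale_square[OF a]
    by (simp add: field_simps power2_eq_square)
  then show ?thesis
    unfolding of_real_divide[symmetric] by simp
qed

lemma cinner_moebius_linear: "cinner (moebius_linear a z) a = cinner z a"
proof -
  have "cinner (moebius_linear a z) a
      = of_real (moebius_scale a) * cinner z a
        + cinner z a * (of_real ((norm a)\<^sup>2) / of_real (1 + moebius_scale a))"
    by (simp add: moebius_linear_def cinner_expand cinner_self)
  then show ?thesis
    unfolding moebius_coefficient by (simp add: algebra_simps)
qed

lemma moebius_linear_centre: "moebius_linear a a = a"
  unfolding moebius_linear_def cinner_self moebius_coefficient vec.scale_left_distrib[symmetric]
  by simp

lemma moebius_linear_twice: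
  "moebius_linear a (moebius_linear a z) = of_real ((moebius_scale a)\<^sup>2) *s z + cinner z a *s a"
proof -
  let ?s = "of_real (moebius_scale a) :: complex" and ?d = "of_real (1 + moebius_scale a) :: complex"
  have d: "?d \<noteq> 0"
    using moebius_scale_pos[OF a] by (simp only: of_real_eq_0_iff)
  have "moebius_linear a (moebius_linear a z)
      = ?s *s (?s *s z + (cinner z a / ?d) *s a) + (cinner z a / ?d) *s a"
    by (subst moebius_linear_def) (simp only: cinner_moebius_linear, simp only: moebius_linear_def)
  also have "\<dots> = of_real ((moebius_scale a)\<^sup>2) *s z + (?d * (cinner z a / ?d)) *s a"
    by (simp add: vec_eq_iff algebra_simps power2_eq_square add_divide_distrib)
  also have "?d * (cinner z a / ?d) = cinner z a"
    using d by simp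
  finally show ?thesis .
qed

lemma cinner_moebius_linear_swap: "cinner (moebius_linear a z) w = cinner z (moebius_linear a w)"
  by (simp add: moebius_linear_def cinner_expand cnj_cinner)

lemma moebius_denominator: "norm z < 1 \<Longrightarrow> 1 - cinner z a \<noteq> 0"
proof
  assume z: "norm z < 1" and "1 - cinner z a = 0"
  then have "cmod (cinner z a) = 1"
    by simp
  then have "1 \<le> norm z * norm a"
    using cmod_cinner_le[of z a] by simp
  moreover have "norm z * norm a < 1"
    using z a mult_strict_mono[of "norm z" 1 "norm a" 1] by simp
  ultimately show False
    by simp
qed

text \<open>
  After division by the squared modulus of \<open>1 - cinner z a\<close> this is the classical identity
  \<open>1 - \<parallel>\<mu> z\<parallel>\<^sup>2 = (1 - \<parallel>a\<parallel>\<^sup>2) (1 - \<parallel>z\<parallel>\<^sup>2) / \<bar>1 - \<langle>z, a\<rangle>\<bar>\<^sup>2\<close> for \<open>\<mu> = ball_moebius a\<close>, which shows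
  that the ball is mapped into itself. It follows from the self-adjointness of the linear part
  and the formula for its square.
\<close>

lemma moebius_norm_numerator:
  "(norm (a - moebius_linear a z))\<^sup>2
     = (cmod (1 - cinner z a))\<^sup>2 - (moebius_scale a)\<^sup>2 * (1 - (norm z)\<^sup>2)"
proof -
  let ?T = "moebius_linear a" and ?c = "cinner z a"
  have "(of_real ((norm (a - ?T z))\<^sup>2) :: complex)
      = cinner a a - cinner a (?T z) - cinner (?T z) a + cinner (?T z) (?T z)"
    unfolding cinner_self[symmetric] by (simp add: cinner_expand)
  also have "cinner (?T z) (?T z) = of_real ((moebius_scale a)\<^sup>2) * cinner z z + ?c * cnj ?c"
    unfolding cinner_moebius_linear_swap[of z] moebius_linear_twice
    by (simp add: cinner_expand)
  also have "cinner a a = 1 - of_real ((moebius_scale a)\<^sup>2)"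
    by (simp add: cinner_self moebius_scale_square[OF a])
  also have "cinner a (?T z) = cnj ?c"
    by (simp add: cinner_moebius_linear cnj_cinner[of "?T z" a, symmetric])
  also have "cinner (?T z) a = ?c"
    by (rule cinner_moebius_linear)
  also have "1 - of_real ((moebius_scale a)\<^sup>2) - cnj ?c - ?c
        + (of_real ((moebius_scale a)\<^sup>2) * cinner z z + ?c * cnj ?c)
      = (1 - ?c) * cnj (1 - ?c) - of_real ((moebius_scale a)\<^sup>2) * (1 - cinner z z)"
    by (simp add: algebra_simps)
  also have "\<dots> = of_real ((cmod (1 - ?c))\<^sup>2 - (moebius_scale a)\<^sup>2 * (1 - (norm z)\<^sup>2))"
    unfolding of_real_diff of_real_mult complex_norm_square[of "1 - ?c"] cinner_self by simp
  finally show ?thesis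
    by (simp only: of_real_eq_iff)
qed

lemma moebius_in_ball:
  assumes z: "norm z < 1"
  shows "norm (ball_moebius a z) < 1"
proof -
  have "0 < (moebius_scale a)\<^sup>2 * (1 - (norm z)\<^sup>2)"
    using moebius_scale_pos[OF a] z by (simp add: power_less_one_iff)
  then have "(norm (a - moebius_linear a z))\<^sup>2 < (cmod (1 - cinner z a))\<^sup>2"
    by (simp add: moebius_norm_numerator)
  then have "norm (a - moebius_linear a z) < cmod (1 - cinner z a)"
    by (rule power_less_imp_less_base) simp
  then show ?thesis
    using moebius_denominator[OF z]
    unfolding ball_moebius_def norm_vector_scale norm_inverse by (simp add: divide_simps)
qed

text \<open>
  Substituting \<open>\<mu> z\<close> for \<open>z\<close> turns both the numerator and the denominator of \<open>\<mu> = ball_moebius a\<close>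
  into the same scalar \<open>(1 - \<parallel>a\<parallel>\<^sup>2) / (1 - \<langle>z, a\<rangle>)\<close>, times \<open>z\<close> in the case of the numerator.
\<close>

lemma moebius_involution:
  assumes z: "norm z < 1"
  shows "ball_moebius a (ball_moebius a z) = z"
proof -
  let ?T = "moebius_linear a" and ?c = "1 - cinner z a" and ?w = "ball_moebius a z"
  let ?s = "of_real ((moebius_scale a)\<^sup>2) :: complex"
  note c = moebius_denominator[OF z]
  have s: "?s \<noteq> 0"
    using moebius_scale_pos[OF a] by (simp only: of_real_eq_0_iff) simp
  have "?c - cinner (a - ?T z) a = ?s"
    by (simp add: cinner_expand cinner_moebius_linear cinner_self moebius_scale_square[OF a])
  moreover have "cinner ?w a = inverse ?c * cinner (a - ?T z) a"
    by (simp only: ball_moebius_def cinner_scale_left)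
  moreover have "1 - inverse ?c * x = inverse ?c * (?c - x)" for x
    unfolding right_diff_distrib[of "inverse ?c" ?c x] left_inverse[OF c] ..
  ultimately have den: "1 - cinner ?w a = inverse ?c * ?s"
    by simp
  have "?T ?w = inverse ?c *s (a - (?s *s z + cinner z a *s a))"
    by (simp add: ball_moebius_def vec.linear_scale[OF linear_moebius_linear]
        vec.linear_diff[OF linear_moebius_linear] moebius_linear_centre moebius_linear_twice)
  also have "a - (?s *s z + cinner z a *s a) = ?c *s a - ?s *s z"
    by (simp add: vec_eq_iff algebra_simps)
  also have "inverse ?c *s (?c *s a - ?s *s z) = a - (inverse ?c * ?s) *s z"
    by (simp only: vec.scale_right_diff_distrib vec.scale_scale left_inverse[OF c] vec.scale_one)
  finally have num: "a - ?T ?w = (inverse ?c * ?s) *s z"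
    by simp
  have den_nz: "inverse ?c * ?s \<noteq> 0"
    using c s by simp
  show ?thesis
    by (simp only: ball_moebius_def[of a ?w] num den vec.scale_scale left_inverse[OF den_nz]
        vec.scale_one)
qed

lemma moebius_centre: "ball_moebius a a = 0"
  by (simp add: ball_moebius_def moebius_linear_centre)

lemma moebius_zero: "ball_moebius a 0 = a"
  by (simp add: ball_moebius_def cinner_def vec.linear_0[OF linear_moebius_linear])

lemma holomorphic_moebius: "holomorphic_map_on (ball_moebius a) (ball 0 1)"
  unfolding holomorphic_map_on_def
proof
  fix z :: "complex ^ 'n"
  assume "z \<in> ball 0 1"
  then have c: "1 - cinner z a \<noteq> 0"
    using moebius_denominator by simp
  let ?T = "moebius_linear a"
  let ?D = "\<lambda>h. inverse (1 - cinner z a) *s (0 - ?T h)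
      + (inverse (1 - cinner z a) * cinner h a * inverse (1 - cinner z a)) *s (a - ?T z)"
  have "bounded_linear ?T"
    unfolding moebius_linear_def divide_inverse
    by (intro bounded_linear_add
        bounded_bilinear.bounded_linear_right[OF bounded_bilinear_vector_scale]
        bounded_linear_compose[OF
          bounded_bilinear.bounded_linear_left[OF bounded_bilinear_vector_scale]]
        bounded_linear_mult_const bounded_linear_cinner_left)
  note T = bounded_linear.has_derivative[OF this has_derivative_ident]
  note C = bounded_linear.has_derivative[OF bounded_linear_cinner_left has_derivative_ident]
  have "(ball_moebius a has_derivative ?D) (at z within ball 0 1)"
    unfolding ball_moebius_def
    by (rule has_derivative_eq_rhs[OF
          bounded_bilinear.FDERIV[OF bounded_bilinear_vector_scale
            Deriv.has_derivative_inverse[where f = "\<lambda>z. 1 - cinner z a", OF c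
              has_derivative_diff[OF has_derivative_const C]]
            has_derivative_diff[OF has_derivative_const T]]])
      simp
  moreover have "Vector_Spaces.linear (*s) (*s) ?D"
    by (rule linear_vectorI)
      (simp_all add: vec.linear_scale[OF linear_moebius_linear]
        vec.linear_add[OF linear_moebius_linear] cinner_expand vec_eq_iff algebra_simps)
  ultimately show "\<exists>D. Vector_Spaces.linear (*s) (*s) D
      \<and> (ball_moebius a has_derivative D) (at z within ball 0 1)"
    by blast
qed

end

section \<open>Fixed points of ball automorphisms\<close>

lemma holomorphic_map_on_compose:
  fixes f :: "complex ^ 'n \<Rightarrow> complex ^ 'm" and g :: "complex ^ 'm \<Rightarrow> complex ^ 'k"
  assumes f: "holomorphic_map_on f S" and g: "holomorphic_map_on g T" and fST: "f \<in> S \<rightarrow> T"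
  shows "holomorphic_map_on (\<lambda>z. g (f z)) S"
  unfolding holomorphic_map_on_def
proof
  fix z
  assume z: "z \<in> S"
  obtain D where D: "Vector_Spaces.linear (*s) (*s) D" "(f has_derivative D) (at z within S)"
    using f z unfolding holomorphic_map_on_def by blast
  obtain E where E: "Vector_Spaces.linear (*s) (*s) E" "(g has_derivative E) (at (f z) within T)"
    using g fST z unfolding holomorphic_map_on_def by blast
  have "(g has_derivative E) (at (f z) within f ` S)"
    using E(2) by (rule has_derivative_subset) (use fST in auto)
  with D(2) have "((\<lambda>z. g (f z)) has_derivative (\<lambda>h. E (D h))) (at z within S)"
    by (rule has_derivative_in_compose)
  moreover have "Vector_Spaces.linear (*s) (*s) (\<lambda>h. E (D h))"
    using Vector_Spaces.linear_compose[OF D(1) E(1)] by (simp add: o_def)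
  ultimately show "\<exists>D. Vector_Spaces.linear (*s) (*s) D
      \<and> ((\<lambda>z. g (f z)) has_derivative D) (at z within S)"
    by blast
qed

text \<open>
  The Schwarz lemma bounds the norm from above for the map and for its inverse, which together
  force the norm to be preserved.
\<close>

lemma ball_automorphism_linear:
  fixes \<phi> \<phi>' :: "complex ^ 'n \<Rightarrow> complex ^ 'n"
  assumes hol: "holomorphic_map_on \<phi> (ball 0 1)" "holomorphic_map_on \<phi>' (ball 0 1)"
    and maps: "\<phi> \<in> ball 0 1 \<rightarrow> ball 0 1" "\<phi>' \<in> ball 0 1 \<rightarrow> ball 0 1"
    and inv: "\<And>z. z \<in> ball 0 1 \<Longrightarrow> \<phi>' (\<phi> z) = z"
    and zero: "\<phi> 0 = 0"
  obtains D where "Vector_Spaces.linear (*s) (*s) D" "\<And>z. norm z < 1 \<Longrightarrow> \<phi> z = D z"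
proof (rule ball_isometry_linear[OF hol(1)])
  show "norm (\<phi> z) = norm z" if z: "norm z < 1" for z
  proof (rule antisym)
    show "norm (\<phi> z) \<le> norm z"
      by (rule ball_map_norm_le[OF hol(1) maps(1) zero z])
    have "norm (\<phi> z) < 1"
      using maps(1) z by (simp add: Pi_iff)
    moreover have "\<phi>' 0 = 0"
      using inv[of 0] zero by simp
    ultimately have "norm (\<phi>' (\<phi> z)) \<le> norm (\<phi> z)"
      using ball_map_norm_le[OF hol(2) maps(2)] by blast
    then show "norm z \<le> norm (\<phi> z)"
      using inv z by simp
  qed
qed (rule that)

text \<open>
  Let \<open>D\<close> be the linear map that \<open>\<tau>\<close> becomes after conjugation with the Moebius involution \<open>m\<close>
  at a point \<open>a\<close> of \<open>S\<close>. A point \<open>p\<close> is fixed by \<open>\<tau>\<close> if and only if \<open>m p\<close> is fixed by \<open>D\<close>. As \<open>m p\<close>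
  is a nonzero multiple of \<open>T (a - p)\<close>, with \<open>T\<close> the linear part of \<open>m\<close>, and \<open>D\<close> is linear, the
  denominator drops out and the condition on \<open>p\<close> becomes that \<open>p - a\<close> lies in the linear
  subspace \<open>W\<close> of all \<open>w\<close> with \<open>D (T w) = T w\<close>. When no proper affine subspace through \<open>a\<close>
  contains \<open>S\<close>, all vectors are in \<open>W\<close>, and by the same equivalence every point is fixed.
\<close>

proposition ball_automorphism_eq_id:
  fixes \<tau> \<tau>' :: "complex ^ 'n \<Rightarrow> complex ^ 'n"
  assumes hol: "holomorphic_map_on \<tau> (ball 0 1)" "holomorphic_map_on \<tau>' (ball 0 1)"
    and maps: "\<tau> \<in> ball 0 1 \<rightarrow> ball 0 1" "\<tau>' \<in> ball 0 1 \<rightarrow> ball 0 1"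
    and inv: "\<And>z. z \<in> ball 0 1 \<Longrightarrow> \<tau>' (\<tau> z) = z"
    and S: "S \<subseteq> ball 0 1" and fixed: "\<And>p. p \<in> S \<Longrightarrow> \<tau> p = p" and aS: "a \<in> S"
    and full: "\<And>V. vec.subspace V \<Longrightarrow> vec.dim V < CARD('n) \<Longrightarrow> \<not> S \<subseteq> (+) a ` V"
    and z: "z \<in> ball 0 1"
  shows "\<tau> z = z"
proof -
  have a: "norm a < 1"
    using aS S by auto
  let ?m = "ball_moebius a" and ?T = "moebius_linear a"
  note lT = linear_moebius_linear[of a]
  have m_maps: "?m \<in> ball 0 1 \<rightarrow> ball 0 1"
    using moebius_in_ball[OF a] by simp
  \<comment> \<open>As \<open>m\<close> is an involution, this is conjugation by \<open>m\<close>.\<close>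
  define conj where "conj = (\<lambda>\<psi> z. ?m (\<psi> (?m z)))"
  have conj: "holomorphic_map_on (conj \<psi>) (ball 0 1)" "conj \<psi> \<in> ball 0 1 \<rightarrow> ball 0 1"
    if "holomorphic_map_on \<psi> (ball 0 1)" "\<psi> \<in> ball 0 1 \<rightarrow> ball 0 1" for \<psi>
  proof -
    have maps: "(\<lambda>z. \<psi> (?m z)) \<in> ball 0 1 \<rightarrow> ball 0 1"
      using m_maps that(2) by (simp add: Pi_iff)
    then show "conj \<psi> \<in> ball 0 1 \<rightarrow> ball 0 1"
      using m_maps by (simp add: conj_def Pi_iff)
    show "holomorphic_map_on (conj \<psi>) (ball 0 1)"
      unfolding conj_def
      by (rule holomorphic_map_on_compose[OF
            holomorphic_map_on_compose[OF holomorphic_moebius[OF a] that(1) m_maps]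
            holomorphic_moebius[OF a] maps])
  qed
  have conj_inv: "conj \<tau>' (conj \<tau> w) = w" if "w \<in> ball 0 1" for w
  proof -
    have "?m w \<in> ball 0 1" "\<tau> (?m w) \<in> ball 0 1"
      using that m_maps maps(1) by (auto simp: Pi_iff)
    then show ?thesis
      using that inv moebius_involution[OF a] by (simp add: conj_def)
  qed
  have "conj \<tau> 0 = 0"
    using fixed[OF aS] by (simp add: conj_def moebius_zero[OF a] moebius_centre[OF a])
  then obtain D where D: "Vector_Spaces.linear (*s) (*s) D"
    and conj_D: "\<And>z. norm z < 1 \<Longrightarrow> conj \<tau> z = D z"
    using ball_automorphism_linear[OF conj(1)[OF hol(1) maps(1)] conj(1)[OF hol(2) maps(2)]
        conj(2)[OF hol(1) maps(1)] conj(2)[OF hol(2) maps(2)] conj_inv] by blast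
  have m_eq: "?m p = inverse (1 - cinner p a) *s ?T (a - p)" for p
    by (simp only: ball_moebius_def vec.linear_diff[OF lT] moebius_linear_centre[OF a])
  define W where "W = {w. D (?T w) = ?T w}"
  have W: "vec.subspace W"
    by (simp add: vec.subspace_def W_def vec.linear_0[OF D] vec.linear_0[OF lT]
        vec.linear_add[OF D] vec.linear_add[OF lT] vec.linear_scale[OF D] vec.linear_scale[OF lT])
  have "S \<subseteq> (+) a ` W"
  proof
    fix p
    assume p: "p \<in> S"
    then have p1: "norm p < 1"
      using S by auto
    note c = moebius_denominator[OF a p1]
    have "D (?m p) = ?m p"
      using conj_D[OF moebius_in_ball[OF a p1]] fixed[OF p] moebius_involution[OF a p1]
      by (simp add: conj_def)
    then have "inverse (1 - cinner p a) *s D (?T (a - p)) = inverse (1 - cinner p a) *s ?T (a - p)"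
      unfolding m_eq vec.linear_scale[OF D] .
    then have "a - p \<in> W"
      using c by (simp add: W_def)
    then have "p - a \<in> W"
      using vec.subspace_neg[OF W, of "a - p"] by simp
    then show "p \<in> (+) a ` W"
      by (rule rev_image_eqI) simp
  qed
  then have "\<not> vec.dim W < CARD('n)"
    using full W by blast
  then have "vec.span W = UNIV"
    using dim_subset_UNIV_cart_gen[of W] vec.dim_eq_full[of W]
    by (simp add: vec_dim_card card_cart_basis vec.dimension_def)
  then have "W = UNIV"
    using vec.span_eq_iff[of W] W by simp
  then have D_T: "D (?T w) = ?T w" for w
    by (auto simp: W_def)
  have z1: "norm z < 1"
    using z by simp
  have "?m (\<tau> z) = D (?m z)"
    using conj_D[OF moebius_in_ball[OF a z1]] moebius_involution[OF a z1] by (simp add: conj_def)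
  also have "\<dots> = ?m z"
    unfolding m_eq vec.linear_scale[OF D] D_T ..
  finally have "?m (?m (\<tau> z)) = ?m (?m z)"
    by simp
  moreover have "norm (\<tau> z) < 1"
    using maps(1) z by (simp add: Pi_iff)
  ultimately show ?thesis
    using moebius_involution[OF a] z1 by simp
qed

section \<open>The automorphism group of the ball\<close>

lemma ball_aut_iff:
  "\<gamma> \<in> carrier ball_aut \<longleftrightarrow> \<gamma> \<in> Bij (ball 0 1) \<and> holomorphic_map_on \<gamma> (ball 0 1)
     \<and> holomorphic_map_on (inv_into (ball 0 1) \<gamma>) (ball 0 1)"
  by (simp add: ball_aut_def)

lemma ball_aut_mult:
  "\<gamma> \<in> carrier ball_aut \<Longrightarrow> \<delta> \<in> carrier ball_aut \<Longrightarrow> \<gamma> \<otimes>\<^bsub>ball_aut\<^esub> \<delta> = compose (ball 0 1) \<gamma> \<delta>"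
  by (simp add: ball_aut_def BijGroup_def)

lemma ball_aut_one: "\<one>\<^bsub>ball_aut\<^esub> = (\<lambda>z\<in>ball 0 1. z)"
  by (simp add: ball_aut_def BijGroup_def)

lemma holomorphic_map_on_cong:
  assumes "holomorphic_map_on f S" and "\<And>z. z \<in> S \<Longrightarrow> f z = g z"
  shows "holomorphic_map_on g S"
  using assms has_derivative_transform[of _ S g f] unfolding holomorphic_map_on_def by metis

text \<open>
  The condition on \<^const>\<open>inv_into\<close> concerns only its values on the ball, where \<open>\<gamma>\<close> has just one
  right inverse; so any right inverse that is visibly holomorphic may take its place.
\<close>

lemma ball_autI:
  assumes bij: "\<gamma> \<in> Bij (ball 0 1)" and hol: "holomorphic_map_on \<gamma> (ball 0 1)"
    and hol': "holomorphic_map_on \<delta> (ball 0 1)"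
    and inv: "\<And>z. z \<in> ball 0 1 \<Longrightarrow> \<delta> z \<in> ball 0 1 \<and> \<gamma> (\<delta> z) = z"
  shows "\<gamma> \<in> carrier ball_aut"
proof -
  have "inj_on \<gamma> (ball 0 1)"
    using bij by (simp add: Bij_def bij_betw_def)
  then have "\<delta> z = inv_into (ball 0 1) \<gamma> z" if "z \<in> ball 0 1" for z
    using inv[OF that] inv_into_f_eq by metis
  then show ?thesis
    using bij hol holomorphic_map_on_cong[OF hol'] by (simp add: ball_aut_iff)
qed

lemma ball_aut_holomorphic: "\<gamma> \<in> carrier ball_aut \<Longrightarrow> holomorphic_map_on \<gamma> (ball 0 1)"
  by (simp add: ball_aut_iff)

lemma ball_aut_inv_holomorphic:
  "\<gamma> \<in> carrier ball_aut \<Longrightarrow> holomorphic_map_on (inv_into (ball 0 1) \<gamma>) (ball 0 1)"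
  by (simp add: ball_aut_iff)

lemma ball_aut_maps: "\<gamma> \<in> carrier ball_aut \<Longrightarrow> \<gamma> \<in> ball 0 1 \<rightarrow> ball 0 1"
  by (simp add: ball_aut_iff Bij_imp_funcset)

lemma ball_aut_inv_maps:
  "\<gamma> \<in> carrier ball_aut \<Longrightarrow> inv_into (ball 0 1) \<gamma> \<in> ball 0 1 \<rightarrow> ball 0 1"
  by (auto simp: ball_aut_iff simp del: mem_ball intro: Bij_inv_into_mem)

lemma ball_aut_left_inv:
  "\<gamma> \<in> carrier ball_aut \<Longrightarrow> z \<in> ball 0 1 \<Longrightarrow> inv_into (ball 0 1) \<gamma> (\<gamma> z) = z"
  by (simp add: ball_aut_iff Bij_def bij_betw_def)

lemma ball_aut_right_inv:
  "\<gamma> \<in> carrier ball_aut \<Longrightarrow> z \<in> ball 0 1 \<Longrightarrow> \<gamma> (inv_into (ball 0 1) \<gamma> z) = z"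
  by (auto simp: ball_aut_iff Bij_def simp del: mem_ball intro: bij_betw_inv_into_right)

lemma restrict_inv_in_ball_aut:
  assumes \<gamma>: "\<gamma> \<in> carrier ball_aut"
  shows "(\<lambda>z\<in>ball 0 1. inv_into (ball 0 1) \<gamma> z) \<in> carrier ball_aut"
proof (rule ball_autI[where \<delta> = \<gamma>])
  show "holomorphic_map_on (\<lambda>z\<in>ball 0 1. inv_into (ball 0 1) \<gamma> z) (ball 0 1)"
    by (rule holomorphic_map_on_cong[OF ball_aut_inv_holomorphic[OF \<gamma>]]) simp
  show "\<gamma> z \<in> ball 0 1 \<and> (\<lambda>z\<in>ball 0 1. inv_into (ball 0 1) \<gamma> z) (\<gamma> z) = z"
    if "z \<in> ball 0 1" for z
    using that ball_aut_maps[OF \<gamma>] ball_aut_left_inv[OF \<gamma>] by (simp add: Pi_iff)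
  show "holomorphic_map_on \<gamma> (ball 0 1)"
    by (rule ball_aut_holomorphic[OF \<gamma>])
  show "(\<lambda>z\<in>ball 0 1. inv_into (ball 0 1) \<gamma> z) \<in> Bij (ball 0 1)"
    using \<gamma> by (simp add: ball_aut_iff restrict_inv_into_Bij)
qed

lemma compose_in_ball_aut:
  assumes \<gamma>: "\<gamma> \<in> carrier ball_aut" and \<delta>: "\<delta> \<in> carrier ball_aut"
  shows "compose (ball 0 1) \<gamma> \<delta> \<in> carrier ball_aut"
proof (rule ball_autI)
  let ?i = "\<lambda>z. inv_into (ball 0 1) \<delta> (inv_into (ball 0 1) \<gamma> z)"
  note maps = ball_aut_maps[OF \<gamma>] ball_aut_maps[OF \<delta>] ball_aut_inv_maps[OF \<gamma>] ball_aut_inv_maps[OF \<delta>]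
  have "holomorphic_map_on (\<lambda>z. \<gamma> (\<delta> z)) (ball 0 1)"
    by (rule holomorphic_map_on_compose[OF ball_aut_holomorphic[OF \<delta>]
          ball_aut_holomorphic[OF \<gamma>] maps(2)])
  then show "holomorphic_map_on (compose (ball 0 1) \<gamma> \<delta>) (ball 0 1)"
    by (rule holomorphic_map_on_cong) (simp add: compose_def)
  show "holomorphic_map_on ?i (ball 0 1)"
    by (rule holomorphic_map_on_compose[OF ball_aut_inv_holomorphic[OF \<gamma>]
          ball_aut_inv_holomorphic[OF \<delta>] maps(3)])
  show "?i z \<in> ball 0 1 \<and> compose (ball 0 1) \<gamma> \<delta> (?i z) = z" if z: "z \<in> ball 0 1" for z
  proof -
    have i: "inv_into (ball 0 1) \<gamma> z \<in> ball 0 1" "?i z \<in> ball 0 1"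
      using maps z by (auto simp: Pi_iff)
    then show ?thesis
      using ball_aut_right_inv[OF \<delta> i(1)] ball_aut_right_inv[OF \<gamma> z] by (simp add: compose_eq)
  qed
  show "compose (ball 0 1) \<gamma> \<delta> \<in> Bij (ball 0 1)"
    using \<gamma> \<delta> by (simp add: ball_aut_iff compose_Bij)
qed

lemma id_in_ball_aut: "(\<lambda>z\<in>ball 0 1. z) \<in> carrier ball_aut"
proof (rule ball_autI[OF id_Bij])
  show id: "holomorphic_map_on (\<lambda>z. z) (ball 0 1 :: (complex ^ 'n) set)"
    unfolding holomorphic_map_on_def
    by (intro ballI exI[of _ "\<lambda>z. z"] conjI linear_vectorI has_derivative_ident) simp_all
  show "holomorphic_map_on (\<lambda>z\<in>ball 0 1. z) (ball 0 1 :: (complex ^ 'n) set)"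
    by (rule holomorphic_map_on_cong[OF id]) simp
qed simp

lemma group_ball_aut: "group ball_aut"
proof (rule groupI)
  fix \<gamma> \<delta> \<epsilon> :: "complex ^ 'n \<Rightarrow> complex ^ 'n"
  assume \<gamma>: "\<gamma> \<in> carrier ball_aut"
  show "\<one>\<^bsub>ball_aut\<^esub> \<otimes>\<^bsub>ball_aut\<^esub> \<gamma> = \<gamma>"
    using \<gamma> ball_aut_mult[OF id_in_ball_aut \<gamma>]
    by (simp add: ball_aut_one ball_aut_iff Bij_imp_extensional Bij_imp_funcset)
  show "\<exists>\<eta>\<in>carrier ball_aut. \<eta> \<otimes>\<^bsub>ball_aut\<^esub> \<gamma> = \<one>\<^bsub>ball_aut\<^esub>"
    using \<gamma> restrict_inv_in_ball_aut[OF \<gamma>] ball_aut_mult[OF restrict_inv_in_ball_aut[OF \<gamma>] \<gamma>]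
    by (intro bexI[OF _ restrict_inv_in_ball_aut[OF \<gamma>]])
      (simp add: ball_aut_one ball_aut_iff Bij_compose_restrict_eq)
  assume \<delta>: "\<delta> \<in> carrier ball_aut"
  show "\<gamma> \<otimes>\<^bsub>ball_aut\<^esub> \<delta> \<in> carrier ball_aut"
    by (simp add: ball_aut_mult compose_in_ball_aut \<gamma> \<delta>)
  assume \<epsilon>: "\<epsilon> \<in> carrier ball_aut"
  show "\<gamma> \<otimes>\<^bsub>ball_aut\<^esub> \<delta> \<otimes>\<^bsub>ball_aut\<^esub> \<epsilon> = \<gamma> \<otimes>\<^bsub>ball_aut\<^esub> (\<delta> \<otimes>\<^bsub>ball_aut\<^esub> \<epsilon>)"
    using compose_assoc[OF ball_aut_maps[OF \<epsilon>], of \<gamma> \<delta>]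
    by (simp add: ball_aut_mult compose_in_ball_aut \<gamma> \<delta> \<epsilon>)
qed (simp add: ball_aut_one id_in_ball_aut)

lemma ball_aut_inv:
  "\<gamma> \<in> carrier ball_aut \<Longrightarrow> inv\<^bsub>ball_aut\<^esub> \<gamma> = (\<lambda>z\<in>ball 0 1. inv_into (ball 0 1) \<gamma> z)"
  by (rule group.inv_equality[OF group_ball_aut])
    (simp_all add: restrict_inv_in_ball_aut ball_aut_mult ball_aut_one,
     simp add: ball_aut_iff Bij_compose_restrict_eq)

section \<open>The group of equivariant pairs\<close>

lemma equivariant_pairs_iff:
  "(\<gamma>, \<psi>) \<in> equivariant_pairs f \<longleftrightarrow> \<gamma> \<in> carrier ball_aut \<and> \<psi> \<in> carrier ball_aut
     \<and> (\<forall>z\<in>ball 0 1. f (\<gamma> z) = \<psi> (f z))"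
  by (auto simp: equivariant_pairs_def DirProd_def)

text \<open>
  The equation for the pair of inverses at \<open>z\<close> is the equation \<open>f (\<gamma> y) = \<psi> (f y)\<close> at the point \<open>y\<close>
  with \<open>\<gamma> y = z\<close>, solved for \<open>f y\<close>.
\<close>

lemma subgroup_equivariant_pairs:
  assumes f: "f \<in> ball 0 1 \<rightarrow> ball 0 1"
  shows "subgroup (equivariant_pairs f) (ball_aut \<times>\<times> ball_aut)"
proof (rule group.subgroupI[OF DirProd_group[OF group_ball_aut group_ball_aut]])
  show "equivariant_pairs f \<subseteq> carrier (ball_aut \<times>\<times> ball_aut)"
    by (auto simp: equivariant_pairs_def)
  have "((\<lambda>z\<in>ball 0 1. z), (\<lambda>z\<in>ball 0 1. z)) \<in> equivariant_pairs f"
    using f by (auto simp: equivariant_pairs_iff id_in_ball_aut Pi_iff)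
  then show "equivariant_pairs f \<noteq> {}"
    by blast
  fix p
  assume p: "p \<in> equivariant_pairs f"
  obtain \<gamma> \<psi> where p_eq: "p = (\<gamma>, \<psi>)"
    by (cases p)
  have \<gamma>: "\<gamma> \<in> carrier ball_aut" and \<psi>: "\<psi> \<in> carrier ball_aut"
    and eq: "\<And>z. z \<in> ball 0 1 \<Longrightarrow> f (\<gamma> z) = \<psi> (f z)"
    using p by (auto simp: p_eq equivariant_pairs_iff)
  have "f (inv_into (ball 0 1) \<gamma> z) = inv_into (ball 0 1) \<psi> (f z)" if z: "z \<in> ball 0 1" for z
  proof -
    let ?y = "inv_into (ball 0 1) \<gamma> z"
    have y: "?y \<in> ball 0 1"
      using ball_aut_inv_maps[OF \<gamma>] z by (rule funcset_mem)
    have "inv_into (ball 0 1) \<psi> (f z) = inv_into (ball 0 1) \<psi> (\<psi> (f ?y))"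
      using eq[OF y] ball_aut_right_inv[OF \<gamma> z] by simp
    also have "\<dots> = f ?y"
      using ball_aut_left_inv[OF \<psi> funcset_mem[OF f y]] .
    finally show ?thesis ..
  qed
  then show "inv\<^bsub>ball_aut \<times>\<times> ball_aut\<^esub> p \<in> equivariant_pairs f"
    using f by (simp add: p_eq inv_DirProd[OF group_ball_aut group_ball_aut \<gamma> \<psi>]
        equivariant_pairs_iff ball_aut_inv \<gamma> \<psi> restrict_inv_in_ball_aut Pi_iff)
  fix q
  assume q: "q \<in> equivariant_pairs f"
  obtain \<delta> \<eta> where q_eq: "q = (\<delta>, \<eta>)"
    by (cases q)
  have \<delta>: "\<delta> \<in> carrier ball_aut" and \<eta>: "\<eta> \<in> carrier ball_aut"
    and eq': "\<And>z. z \<in> ball 0 1 \<Longrightarrow> f (\<delta> z) = \<eta> (f z)"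
    using q by (auto simp: q_eq equivariant_pairs_iff)
  show "p \<otimes>\<^bsub>ball_aut \<times>\<times> ball_aut\<^esub> q \<in> equivariant_pairs f"
    using f eq eq' ball_aut_maps[OF \<delta>]
    by (simp add: p_eq q_eq equivariant_pairs_iff ball_aut_mult \<gamma> \<psi> \<delta> \<eta>
        compose_in_ball_aut compose_eq Pi_iff)
qed

lemma group_hom_fst: "group G \<Longrightarrow> group H \<Longrightarrow> group_hom (G \<times>\<times> H) G fst"
  unfolding group_hom_def group_hom_axioms_def
  by (auto simp: DirProd_group intro!: homI)

lemma group_hom_snd: "group G \<Longrightarrow> group H \<Longrightarrow> group_hom (G \<times>\<times> H) H snd"
  unfolding group_hom_def group_hom_axioms_def
  by (auto simp: DirProd_group intro!: homI)

lemma group_source_group: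
  assumes f: "f \<in> ball 0 1 \<rightarrow> ball 0 1"
  shows "group (source_group f)"
  unfolding source_group_def
  by (intro group.subgroup_imp_group group_ball_aut subgroup_equivariant_pairs[OF f]
      group_hom.subgroup_img_is_subgroup[OF group_hom_fst[OF group_ball_aut group_ball_aut]])

lemma group_target_group:
  assumes f: "f \<in> ball 0 1 \<rightarrow> ball 0 1"
  shows "group (target_group f)"
  unfolding target_group_def
  by (intro group.subgroup_imp_group group_ball_aut subgroup_equivariant_pairs[OF f]
      group_hom.subgroup_img_is_subgroup[OF group_hom_snd[OF group_ball_aut group_ball_aut]])

text \<open>
  The automorphism obtained from \<open>\<psi>\<close> followed by the inverse of \<open>\<psi>'\<close> fixes the image of \<open>f\<close>
  pointwise, and minimality says that this image spans the whole space affinely.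
\<close>

proposition equivariant_pairs_unique:
  fixes f :: "complex ^ 'n \<Rightarrow> complex ^ 'm"
  assumes f: "f \<in> ball 0 1 \<rightarrow> ball 0 1" and min: "minimal_map f"
    and "(\<gamma>, \<psi>) \<in> equivariant_pairs f" and "(\<gamma>, \<psi>') \<in> equivariant_pairs f"
  shows "\<psi> = \<psi>'"
proof -
  have \<psi>: "\<psi> \<in> carrier ball_aut" and \<psi>': "\<psi>' \<in> carrier ball_aut"
    and eq: "\<And>z. z \<in> ball 0 1 \<Longrightarrow> \<psi> (f z) = \<psi>' (f z)"
    using assms(3,4) by (auto simp: equivariant_pairs_iff)
  note maps = ball_aut_maps[OF \<psi>] ball_aut_maps[OF \<psi>'] ball_aut_inv_maps[OF \<psi>] ball_aut_inv_maps[OF \<psi>']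
  let ?\<tau> = "\<lambda>z. inv_into (ball 0 1) \<psi>' (\<psi> z)" and ?\<tau>' = "\<lambda>z. inv_into (ball 0 1) \<psi> (\<psi>' z)"
  have "?\<tau> z = z" if "z \<in> ball 0 1" for z
  proof (rule ball_automorphism_eq_id[where S = "f ` ball 0 1" and a = "f 0" and \<tau> = ?\<tau>
        and \<tau>' = ?\<tau>'])
    show "holomorphic_map_on ?\<tau> (ball 0 1)" "holomorphic_map_on ?\<tau>' (ball 0 1)"
      by (rule holomorphic_map_on_compose[OF ball_aut_holomorphic[OF \<psi>]
            ball_aut_inv_holomorphic[OF \<psi>'] maps(1)],
          rule holomorphic_map_on_compose[OF ball_aut_holomorphic[OF \<psi>']
            ball_aut_inv_holomorphic[OF \<psi>] maps(2)])
    show "?\<tau> \<in> ball 0 1 \<rightarrow> ball 0 1" "?\<tau>' \<in> ball 0 1 \<rightarrow> ball 0 1"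
      using maps by (simp_all add: Pi_iff)
    show "?\<tau>' (?\<tau> w) = w" if w: "w \<in> ball 0 1" for w
      using ball_aut_right_inv[OF \<psi>' funcset_mem[OF maps(1) w]] ball_aut_left_inv[OF \<psi> w] by simp
    show "f ` ball 0 1 \<subseteq> ball 0 1"
      using f by blast
    show "?\<tau> p = p" if p: "p \<in> f ` ball 0 1" for p
    proof -
      obtain w where w: "w \<in> ball 0 1" "p = f w"
        using p by blast
      show ?thesis
        using eq[OF w(1)] ball_aut_left_inv[OF \<psi>' funcset_mem[OF f w(1)]] by (simp add: w(2))
    qed
    show "\<not> f ` ball 0 1 \<subseteq> (+) (f 0) ` V" if "vec.subspace V" "vec.dim V < CARD('m)" for V
      using min that unfolding minimal_map_def by blast
  qed (use that in simp_all)
  then have "\<psi> z = \<psi>' z" if "z \<in> ball 0 1" for z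
    using that ball_aut_right_inv[OF \<psi>' funcset_mem[OF maps(1) that]] by simp
  then show ?thesis
    using \<psi> \<psi>' by (intro extensionalityI[where A = "ball 0 1"])
      (auto simp: ball_aut_iff Bij_imp_extensional)
qed

theorem theorem3p1:
  fixes f :: "complex ^ 'n \<Rightarrow> complex ^ 'm"
  assumes "f \<in> ball 0 1 \<rightarrow> ball 0 1"
    and "holomorphic_map_on f (ball 0 1)"
    and "minimal_map f"
  shows "\<exists>\<Phi>. group_hom (source_group f) (target_group f) \<Phi> \<and>
           (\<forall>\<gamma>\<in>carrier (source_group f). \<forall>z\<in>ball 0 1. f (\<gamma> z) = \<Phi> \<gamma> (f z))"
proof -
  note f = assms(1)
  define \<Phi> where "\<Phi> \<gamma> = (THE \<psi>. (\<gamma>, \<psi>) \<in> equivariant_pairs f)" for \<gamma>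
  have \<Phi>_eq: "\<Phi> \<gamma> = \<psi>" if "(\<gamma>, \<psi>) \<in> equivariant_pairs f" for \<gamma> \<psi>
    unfolding \<Phi>_def using that equivariant_pairs_unique[OF f assms(3)] by blast
  have \<Phi>: "(\<gamma>, \<Phi> \<gamma>) \<in> equivariant_pairs f" if "\<gamma> \<in> carrier (source_group f)" for \<gamma>
    using that \<Phi>_eq by (auto simp: source_group_def)
  have "\<Phi> \<in> hom (source_group f) (target_group f)"
  proof (rule homI)
    show "\<Phi> \<gamma> \<in> carrier (target_group f)" if "\<gamma> \<in> carrier (source_group f)" for \<gamma>
      using \<Phi>[OF that] by (force simp: target_group_def)
    show "\<Phi> (\<gamma> \<otimes>\<^bsub>source_group f\<^esub> \<delta>) = \<Phi> \<gamma> \<otimes>\<^bsub>target_group f\<^esub> \<Phi> \<delta>"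
      if "\<gamma> \<in> carrier (source_group f)" "\<delta> \<in> carrier (source_group f)" for \<gamma> \<delta>
    proof (rule \<Phi>_eq)
      show "(\<gamma> \<otimes>\<^bsub>source_group f\<^esub> \<delta>, \<Phi> \<gamma> \<otimes>\<^bsub>target_group f\<^esub> \<Phi> \<delta>) \<in> equivariant_pairs f"
        using subgroup.m_closed[OF subgroup_equivariant_pairs[OF f] \<Phi>[OF that(1)] \<Phi>[OF that(2)]]
        by (simp add: source_group_def target_group_def)
    qed
  qed
  then have "group_hom (source_group f) (target_group f) \<Phi>"
    using group_source_group[OF f] group_target_group[OF f]
    by (simp add: group_hom_def group_hom_axioms_def)
  moreover have "\<forall>\<gamma>\<in>carrier (source_group f). \<forall>z\<in>ball 0 1. f (\<gamma> z) = \<Phi> \<gamma> (f z)"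
    using \<Phi> by (simp add: equivariant_pairs_iff)
  ultimately show ?thesis
    by blast
qed

end
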